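(* Let $\mathcal{C}_r$ be the class of all semigroups satisfying $(\forall a)(\exists x)\colon a=a^2xa$, let $\mathcal{C}_l$ be the class of all semigroups satisfying $(\forall a)(\exists x)\colon a=axa^2$, and let $\mathcal{CR}$ be the class of all completely regular semigroups. Then $\mathcal{C}_r=\mathcal{C}_l=\mathcal{CR}$.
   Context: A semigroup is completely regular if it is a union of groups, i.e. every element lies in a subgroup of the semigroup. *)

theory Defs
  imports "HOL-Algebra.Group"
begin

text \<open>
  Semigroups are explicit-carrier structures in the style of HOL-Algebra, which has no semigroup
  record of its own.  The empty carrier is not excluded; it satisfies all three defining
  conditions below vacuously.
\<close>

record 'a sgrp = "'a partial_object" +
  smult :: "'a \<Rightarrow> 'a \<Rightarrow> 'a"  (infixl \<open>\<odot>\<index>\<close> 70)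

locale sgrp =
  fixes S :: "'a sgrp" (structure)
  assumes smult_closed: "\<lbrakk>x \<in> carrier S; y \<in> carrier S\<rbrakk> \<Longrightarrow> x \<odot> y \<in> carrier S"
    and smult_assoc:
      "\<lbrakk>x \<in> carrier S; y \<in> carrier S; z \<in> carrier S\<rbrakk> \<Longrightarrow> (x \<odot> y) \<odot> z = x \<odot> (y \<odot> z)"

text \<open>
  A subgroup of a semigroup is a subset that is a group under the restricted multiplication.
  Its identity is an idempotent of the semigroup that need not be an identity of the whole
  semigroup, so HOL-Algebra's \<^const>\<open>subgroup\<close> does not apply.
\<close>

definition sgrp_subgroup :: "'a set \<Rightarrow> 'a sgrp \<Rightarrow> bool" where
  "sgrp_subgroup H S \<longleftrightarrow>
     H \<subseteq> carrier S \<and> (\<exists>e. group \<lparr>carrier = H, monoid.mult = smult S, one = e\<rparr>)"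

definition completely_regular :: "'a sgrp \<Rightarrow> bool" where
  "completely_regular S \<longleftrightarrow> sgrp S \<and> (\<forall>a\<in>carrier S. \<exists>H. sgrp_subgroup H S \<and> a \<in> H)"

definition class_Cr :: "'a sgrp set" where
  "class_Cr = {S. sgrp S \<and>
     (\<forall>a\<in>carrier S. \<exists>x\<in>carrier S. a = a \<odot>\<^bsub>S\<^esub> a \<odot>\<^bsub>S\<^esub> x \<odot>\<^bsub>S\<^esub> a)}"

definition class_Cl :: "'a sgrp set" where
  "class_Cl = {S. sgrp S \<and>
     (\<forall>a\<in>carrier S. \<exists>x\<in>carrier S. a = a \<odot>\<^bsub>S\<^esub> x \<odot>\<^bsub>S\<^esub> a \<odot>\<^bsub>S\<^esub> a)}"

definition class_CR :: "'a sgrp set" where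
  "class_CR = {S. completely_regular S}"

end

theory Submission
  imports Defs
begin

text \<open>
  The point is that a regular semigroup with \<open>a \<in> a\<^sup>2S\<close> for all \<open>a\<close> also satisfies \<open>a \<in> Sa\<^sup>2\<close>.
  Let \<open>b\<close> be an inverse of \<open>a\<close>, \<open>e = ab\<close> and \<open>f = ba\<close>.  Right regularity of \<open>a\<close> and \<open>b\<close> gives
  \<open>fe \<R> f\<close> and \<open>ef \<R> e\<close>, so \<open>efe\<close> has a right inverse \<open>u\<close> in the monoid \<open>eSe\<close>.
  Right regularity of \<open>u\<close> gives \<open>u\<close> a right inverse as well, so \<open>u\<close> is a unit and \<open>u(efe) = e\<close>,
  whence \<open>a = ea = u(efe)a = uba\<^sup>2\<close>.  An element of \<open>a\<^sup>2S \<inter> Sa\<^sup>2\<close> is a unit of some local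
  monoid \<open>eSe\<close>, and these units form a subgroup.  The other class is handled in the opposite semigroup.
\<close>

definition opposite :: "'a sgrp \<Rightarrow> 'a sgrp" where
  "opposite S = \<lparr>carrier = carrier S, smult = (\<lambda>x y. y \<odot>\<^bsub>S\<^esub> x)\<rparr>"

lemma carrier_opposite [simp]: "carrier (opposite S) = carrier S"
  and smult_opposite [simp]: "x \<odot>\<^bsub>opposite S\<^esub> y = y \<odot>\<^bsub>S\<^esub> x"
  by (simp_all add: opposite_def)

context sgrp
begin

lemma sgrp_opposite: "sgrp (opposite S)"
  by unfold_locales (simp_all add: smult_closed smult_assoc)

lemma inverse_of_regular:
  assumes a: "a \<in> carrier S" and x: "x \<in> carrier S" and axa: "a \<odot> x \<odot> a = a"
  obtains b where "b \<in> carrier S" "a \<odot> b \<odot> a = a" "b \<odot> a \<odot> b = b"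
proof
  have axa': "a \<odot> (x \<odot> (a \<odot> z)) = a \<odot> z" if "z \<in> carrier S" for z
    using a x axa that by (metis smult_assoc smult_closed)
  show "x \<odot> a \<odot> x \<in> carrier S" "a \<odot> (x \<odot> a \<odot> x) \<odot> a = a" 
    "(x \<odot> a \<odot> x) \<odot> a \<odot> (x \<odot> a \<odot> x) = x \<odot> a \<odot> x"
    using a x axa axa' by (simp_all add: smult_assoc smult_closed)
qed

text \<open>Multiplying \<open>uw\<close> on the left by \<open>g\<close> cancels one factor
  \<open>u\<close>, so \<open>w\<close> is a right inverse of \<open>u\<close>. The two one-sided
  inverses \<open>g\<close> and \<open>w\<close> of \<open>u\<close> are then compared as in a
  monoid.\<close>

lemma right_inverse_is_left_inverse:
  assumes S: "e \<in> carrier S" "g \<in> carrier S" "u \<in> carrier S" "w \<in> carrier S"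
    and eu: "e \<odot> u = u" and ge: "g \<odot> e = g"
    and gu: "g \<odot> u = e" and uw: "u \<odot> u \<odot> w = u"
  shows "u \<odot> g = e"
proof -
  have "u \<odot> w = g \<odot> u \<odot> (u \<odot> w)"
    using S eu gu by (metis smult_assoc)
  also have "\<dots> = g \<odot> (u \<odot> u \<odot> w)"
    using S by (simp add: smult_assoc smult_closed)
  also have "\<dots> = e"
    by (simp add: gu uw)
  finally have ew: "u \<odot> w = e" .
  have "g = g \<odot> (u \<odot> w)"
    using ew ge by simp
  also have "\<dots> = e \<odot> w"
    using S gu by (simp flip: smult_assoc)
  finally have "u \<odot> g = u \<odot> (e \<odot> w)"
    by simp
  \<comment> \<open>As \<open>w\<close> is not assumed to satisfy \<open>e \<odot> w = w\<close>,
    the factor \<open>e\<close> is expanded to \<open>u \<odot> w\<close> and absorbed by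
    \<open>uw\<close>.\<close>
  also have "\<dots> = u \<odot> (u \<odot> w \<odot> w)"
    by (simp add: ew)
  also have "\<dots> = u \<odot> w"
    using S uw by (metis smult_assoc smult_closed)
  finally show ?thesis
    using ew by simp
qed

lemma left_regular_if_regular_right_regular:
  assumes regular: "\<And>a. a \<in> carrier S \<Longrightarrow> \<exists>x\<in>carrier S. a \<odot> x \<odot> a = a"
    and right_regular: "\<And>a. a \<in> carrier S \<Longrightarrow> \<exists>x\<in>carrier S. a \<odot> a \<odot> x = a"
    and a: "a \<in> carrier S"
  shows "\<exists>x\<in>carrier S. x \<odot> (a \<odot> a) = a"
proof -
  obtain b where b: "b \<in> carrier S" and aba: "a \<odot> b \<odot> a = a" and bab: "b \<odot> a \<odot> b = b"
    using regular[OF a] inverse_of_regular a by metis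
  obtain t where t: "t \<in> carrier S" and at: "a \<odot> a \<odot> t = a"
    using right_regular[OF a] by blast
  obtain s where s: "s \<in> carrier S" and bs: "b \<odot> b \<odot> s = b"
    using right_regular[OF b] by blast
  note closed = a b t s
  have aba': "a \<odot> (b \<odot> (a \<odot> z)) = a \<odot> z" if "z \<in> carrier S" for z
    using closed aba that by (metis smult_assoc smult_closed)
  have bab': "b \<odot> (a \<odot> (b \<odot> z)) = b \<odot> z" if "z \<in> carrier S" for z
    using closed bab that by (metis smult_assoc smult_closed)
  have at': "a \<odot> (a \<odot> (t \<odot> z)) = a \<odot> z" if "z \<in> carrier S" for z
    using closed at that by (metis smult_assoc smult_closed)
  have bs': "b \<odot> (b \<odot> (s \<odot> z)) = b \<odot> z" if "z \<in> carrier S" for z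
    using closed bs that by (metis smult_assoc smult_closed)
  note laws = smult_assoc smult_closed aba' bab' at' bs' 
  define e where "e = a \<odot> b"
  define g where "g = e \<odot> (b \<odot> a) \<odot> e"
  \<comment> \<open>The factors of \<open>u\<close> undo those of \<open>g\<close> in turn:
    \<open>b(aat)bse = babse = bse\<close>, and then \<open>e(bse) = a(bbs)e = abe = e\<close>. The
    outer \<open>a\<close> and \<open>e\<close> keep \<open>u\<close> in the local monoid of
    \<open>e\<close>.\<close>
  define u where "u = a \<odot> t \<odot> b \<odot> s \<odot> e"
  have e: "e \<in> carrier S" and g: "g \<in> carrier S" and u: "u \<in> carrier S"
    using closed by (simp_all add: e_def g_def u_def smult_closed)
  obtain w where w: "w \<in> carrier S" and uw: "u \<odot> u \<odot> w = u"
    using right_regular[OF u] by blast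
  have "u \<odot> g = e"
  proof (rule right_inverse_is_left_inverse[OF e g u w _ _ _ uw])
    show "e \<odot> u = u" "g \<odot> e = g" "g \<odot> u = e"
      using closed by (simp_all add: e_def g_def u_def laws)
  qed
  then have "a = u \<odot> g \<odot> a"
    using aba by (simp add: e_def)
  \<comment> \<open>The last factor \<open>e\<close> of \<open>g\<close> is absorbed by
    \<open>a\<close>, which leaves \<open>ga = eba \<odot> a\<close>.\<close>
  also have "\<dots> = (u \<odot> e \<odot> b) \<odot> (a \<odot> a)"
    using closed e u aba by (simp add: g_def e_def laws)
  finally show ?thesis
    using b e u by (metis smult_closed)
qed

text \<open>The condition is symmetric in \<open>h\<close> and \<open>k\<close>, so \<open>H\<close>
  contains inverses; a product is inverted by the inverses in reverse order.\<close>

lemma sgrp_subgroup_units_of_local_monoid: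
  assumes e: "e \<in> carrier S" and ee: "e \<odot> e = e"
  defines "H \<equiv> {h \<in> carrier S. e \<odot> h = h \<and> h \<odot> e = h \<and>
    (\<exists>k\<in>carrier S. e \<odot> k = k \<and> k \<odot> e = k \<and> h \<odot> k = e \<and> k \<odot> h = e)}"
  shows "sgrp_subgroup H S"
  unfolding sgrp_subgroup_def
proof (intro conjI exI)
  show "H \<subseteq> carrier S"
    by (auto simp: H_def)
  show "group \<lparr>carrier = H, monoid.mult = smult S, one = e\<rparr>"
  proof (rule groupI, simp_all)
    fix x y assume x: "x \<in> H" and y: "y \<in> H"
    from x obtain k where k: "k \<in> carrier S" "e \<odot> k = k" "k \<odot> e = k" "x \<odot> k = e" "k \<odot> x = e"
      by (auto simp: H_def)
    from y obtain l where l: "l \<in> carrier S" "e \<odot> l = l" "l \<odot> e = l" "y \<odot> l = e" "l \<odot> y = e"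
      by (auto simp: H_def)
    have xy: "x \<in> carrier S" "e \<odot> x = x" "x \<odot> e = x" "y \<in> carrier S" "e \<odot> y = y" "y \<odot> e = y"
      using x y by (auto simp: H_def)
    have "x \<odot> y \<odot> (l \<odot> k) = e"
      using k l xy by (metis smult_assoc smult_closed)
    moreover have "l \<odot> k \<odot> (x \<odot> y) = e"
      using k l xy by (metis smult_assoc smult_closed)
    moreover have "e \<odot> (l \<odot> k) = l \<odot> k" "l \<odot> k \<odot> e = l \<odot> k" "l \<odot> k \<in> carrier S"
      "e \<odot> (x \<odot> y) = x \<odot> y" "x \<odot> y \<odot> e = x \<odot> y" "x \<odot> y \<in> carrier S"
      using e k l xy by (metis smult_assoc smult_closed)+
    ultimately show "x \<odot> y \<in> H"
      unfolding H_def by blast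
  qed (use e ee in \<open>auto simp: H_def smult_assoc\<close>)
qed

lemma in_sgrp_subgroup:
  assumes a: "a \<in> carrier S"
    and p: "p \<in> carrier S" "a \<odot> a \<odot> p = a"
    and q: "q \<in> carrier S" "q \<odot> (a \<odot> a) = a"
  shows "\<exists>H. sgrp_subgroup H S \<and> a \<in> H"
proof -
  define e where "e = a \<odot> p"
  have e: "e \<in> carrier S"
    using a p by (simp add: e_def smult_closed)
  \<comment> \<open>Both \<open>ap\<close> and \<open>qa\<close> equal \<open>qaap\<close>. This
    makes \<open>e\<close> a left and a right identity for \<open>a\<close>.\<close>
  have qa: "q \<odot> a = e"
    unfolding e_def using a p q by (metis smult_assoc smult_closed)
  have ea: "e \<odot> a = a"
    using a q by (simp add: smult_assoc flip: qa)
  have ae: "a \<odot> e = a"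
    using a p by (simp add: e_def flip: smult_assoc)
  have ee: "e \<odot> e = e"
    using a p e ea by (metis e_def smult_assoc)
  have qe: "q \<odot> e = e \<odot> p"
    using a p q qa by (metis e_def smult_assoc)
  \<comment> \<open>The inverse of \<open>a\<close> is \<open>qap\<close>, which equals both
    \<open>qe\<close> and \<open>ep\<close>.\<close>
  have "q \<odot> e \<in> carrier S" "e \<odot> (q \<odot> e) = q \<odot> e" "q \<odot> e \<odot> e = q \<odot> e"
    "a \<odot> (q \<odot> e) = e" "q \<odot> e \<odot> a = e"
    using a p q e ea ae ee qe qa by (metis e_def smult_assoc smult_closed)+
  then show ?thesis
    using sgrp_subgroup_units_of_local_monoid[OF e ee] a ea ae by blast
qed

text \<open>Bracketing \<open>aaxa\<close> as \<open>aa(xa)\<close> gives right regularity, and as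
  \<open>a(ax)a\<close> gives regularity.\<close>

lemma bilaterally_regular_if_Cr:
  assumes Cr: "\<And>a. a \<in> carrier S \<Longrightarrow> \<exists>x\<in>carrier S. a = a \<odot> a \<odot> x \<odot> a"
    and a: "a \<in> carrier S"
  shows "(\<exists>p\<in>carrier S. a \<odot> a \<odot> p = a) \<and> (\<exists>q\<in>carrier S. q \<odot> (a \<odot> a) = a)"
proof -
  have right: "\<exists>p\<in>carrier S. c \<odot> c \<odot> p = c" if "c \<in> carrier S" for c
    using Cr[OF that] that by (metis smult_assoc smult_closed)
  have "\<exists>x\<in>carrier S. c \<odot> x \<odot> c = c" if "c \<in> carrier S" for c
    using Cr[OF that] that by (metis smult_assoc smult_closed)
  then show ?thesis
    using left_regular_if_regular_right_regular right a by blast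
qed

end

lemma class_Cr_subset_class_CR: "class_Cr \<subseteq> class_CR"
proof
  fix S :: "'a sgrp" assume "S \<in> class_Cr"
  then interpret sgrp S
    by (simp add: class_Cr_def)
  have "\<exists>H. sgrp_subgroup H S \<and> a \<in> H" if "a \<in> carrier S" for a
    using bilaterally_regular_if_Cr[of a] in_sgrp_subgroup[of a] \<open>S \<in> class_Cr\<close> that
    by (auto simp: class_Cr_def)
  then show "S \<in> class_CR"
    by (simp add: class_CR_def completely_regular_def sgrp_axioms)
qed

lemma class_Cl_subset_class_CR: "class_Cl \<subseteq> class_CR"
proof
  fix S :: "'a sgrp" assume S: "S \<in> class_Cl"
  then interpret sgrp S
    by (simp add: class_Cl_def)
  interpret op: sgrp "opposite S"
    by (rule sgrp_opposite)
  have "\<exists>H. sgrp_subgroup H S \<and> a \<in> H" if a: "a \<in> carrier S" for a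
  proof -
    \<comment> \<open>Read backwards, \<open>ccxc\<close> is \<open>cxcc\<close>, so the same
      \<open>x\<close> serves.\<close>
    have "\<exists>x\<in>carrier (opposite S). c = c \<odot>\<^bsub>opposite S\<^esub> c \<odot>\<^bsub>opposite S\<^esub> x \<odot>\<^bsub>opposite S\<^esub> c"
      if "c \<in> carrier (opposite S)" for c
      using S that by (auto simp: class_Cl_def smult_assoc smult_closed)
    from op.bilaterally_regular_if_Cr[OF this, of a] a
    obtain p q where "p \<in> carrier S" "p \<odot>\<^bsub>S\<^esub> (a \<odot>\<^bsub>S\<^esub> a) = a" "q \<in> carrier S" "a \<odot>\<^bsub>S\<^esub> a \<odot>\<^bsub>S\<^esub> q = a"
      by auto
    then show ?thesis
      using in_sgrp_subgroup a by blast
  qed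
  then show "S \<in> class_CR"
    by (simp add: class_CR_def completely_regular_def sgrp_axioms)
qed

lemma class_CR_subset: "class_CR \<subseteq> class_Cr \<inter> class_Cl"
proof
  fix S :: "'a sgrp" assume S: "S \<in> class_CR"
  then interpret sgrp S
    by (simp add: class_CR_def completely_regular_def)
  have "\<exists>x\<in>carrier S. a = a \<odot>\<^bsub>S\<^esub> a \<odot>\<^bsub>S\<^esub> x \<odot>\<^bsub>S\<^esub> a \<and> a = a \<odot>\<^bsub>S\<^esub> x \<odot>\<^bsub>S\<^esub> a \<odot>\<^bsub>S\<^esub> a" if a: "a \<in> carrier S" for a
  proof -
    obtain H e where H: "H \<subseteq> carrier S" "a \<in> H"
      and G: "group \<lparr>carrier = H, monoid.mult = smult S, one = e\<rparr>"
      using S a by (auto simp: class_CR_def completely_regular_def sgrp_subgroup_def)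
    interpret G: group "\<lparr>carrier = H, monoid.mult = smult S, one = e\<rparr>"
      by (rule G)
    obtain y where y: "y \<in> H" "y \<odot>\<^bsub>S\<^esub> a = e" "a \<odot>\<^bsub>S\<^esub> y = e"
      using G.l_inv_ex[of a] G.r_inv_ex[of a] G.inv_equality G.r_inv G.l_inv G.inv_closed H by force
    have units: "e \<odot>\<^bsub>S\<^esub> a = a" "a \<odot>\<^bsub>S\<^esub> e = a" "e \<odot>\<^bsub>S\<^esub> y = y" "y \<odot>\<^bsub>S\<^esub> e = y"
      using G.l_one G.r_one H y by auto
    have S: "y \<in> carrier S"
      using y H by blast
    \<comment> \<open>The square of the group inverse cancels \<open>aa\<close> on either side, so
      one witness settles both equations.\<close>
    have "a = a \<odot>\<^bsub>S\<^esub> a \<odot>\<^bsub>S\<^esub> (y \<odot>\<^bsub>S\<^esub> y) \<odot>\<^bsub>S\<^esub> a" "a = a \<odot>\<^bsub>S\<^esub> (y \<odot>\<^bsub>S\<^esub> y) \<odot>\<^bsub>S\<^esub> a \<odot>\<^bsub>S\<^esub> a"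
      using a S y units by (metis smult_assoc smult_closed)+
    then show ?thesis
      using S smult_closed by blast
  qed
  then show "S \<in> class_Cr \<inter> class_Cl"
    unfolding class_Cr_def class_Cl_def using sgrp_axioms by blast
qed

theorem theorem2p10:
  shows "(class_Cr :: 'a sgrp set) = class_Cl \<and> (class_Cl :: 'a sgrp set) = class_CR"
  using class_Cr_subset_class_CR class_Cl_subset_class_CR class_CR_subset by blast

end
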